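(* Let $(\sigma_k)_{k\ge1}$ be a nondecreasing sequence of positive numbers with $\lim_{k\to\infty}\sigma_k=+\infty$, let $M\ge1$, and for each $k\ge 1$ let $x^k$ be a global minimizer of $$(P_k)\quad \min_{0\le x\le M}\ f(x)+\frac{\sigma_k}{2}\sum_{i=1}^{n_1}(e^T\bar x_i-1)^2 .$$ Let $K\subseteq\{1,2,\dots\}$ be an infinite set such that $\lim_{k\to\infty,\,k\in K}x^k=z$, where $z$ is a global minimizer of $$(R)\quad \min_{x\in\mathbb R^n} f(x)\quad\text{s.t. } e^T\bar x_i=1,\ i=1,\dots,n_1,\quad x\ge 0.$$ Let $$(P)\quad \min_{x\in\mathbb R^n} f(x)\quad\text{s.t. } e^T\bar x_i=1,\ i=1,\dots,n_1,\quad x\ge 0,\quad \|x\|_0\le n_1.$$ (i) If $\|z\|_0=n_1$, then there exists an integer $k_0>0$ such that $\Gamma(z)=\mathcal J^k$ for all $k\ge k_0$, $k\in K$. (ii) If $\|z\|_0>n_1$ and $|\mathcal J_i(z)|=1$ for all $i=1,\dots,n_1$, then there exist a global minimizer $x^*$ of $(P)$ and a positive integer $k_0$ such that $\Gamma(x^* )=\mathcal J^k$ for all $k\ge k_0$, $k\in K$. (iii) If $\|z\|_0>n_1$ and $|\mathcal J_i(z)|>1$ for some $i\in\{1,\dots,n_1\}$, then there exist a global minimizer $x^*$ of $(P)$, a subsequence $\{x^k\}_{k\in K'}$ (with $K'\subseteq K$ infinite) and a positive integer $k_0$ such that $\Gamma(x^* )=\mathcal J^k$ for all $k\ge k_0$,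 $k\in K'$.
   Context: Let $n_1\le n_2$ be positive integers and $n=n_1n_2$. A vector $x\in\mathbb R^n$ is partitioned into blocks $x=(\bar x_1^T,\dots,\bar x_{n_1}^T)^T$ with $\bar x_i\in\mathbb R^{n_2}$; $e\in\mathbb R^{n_2}$ is the all-ones vector; $\|x\|_0$ is the number of nonzero entries of $x$; inequalities between vectors (and between a vector and a scalar) are entrywise. The support set of $x$ is $\Gamma(x)=\{l: x_l>0\}$. Largest-entry index sets: $\mathcal J_i(z)=\arg\max_{p\in\{1,\dots,n_2\}}(\bar z_i)_p$ is the set of positions of the largest entries of block $i$ of $z$. For the iterate $x^k$: $\mathcal J^k_i=\arg\max_{p}(\bar x^k_i)_p$, $p^k_i=\min\{p:p\in\mathcal J^k_i\}$, and $\mathcal J^k=\bigcup_{i=1}^{n_1}\{p^k_i+n_2(i-1)\}\subseteq\{1,\dots,n\}$. Hypergraph data: $G_1=(V_1,E_1)$, $G_2=(V_2,E_2)$ are 3-uniform hypergraphs with $V_1=\{1,\dots,n_1\}$, $V_2=\{1,\dots,n_2\}$; every hyperedge is a triple of three distinct points. The score tensor $\mathcal B\in\mathbb R^{n_1\times n_2\times n_1\times n_2\times n_1\times n_2}$ satisfies: $\mathcal B_{l_1l_2j_1j_2k_1k_2}\ge 0$ always; it is $0$ unless $(l_1,j_1,k_1)\in E_1$ and $(l_2,j_2,k_2)\in E_2$; and it is invariant under applying the same permutation to $(l_1,j_1,k_1)$ and to $(l_2,j_2,k_2)$. The tensor $\mathcal A\in\mathbb R^{n\times n\times n}$ is $\mathcal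 A_{ljk}=\mathcal B_{l_1l_2j_1j_2k_1k_2}$ with $l=(l_1-1)n_2+l_2$, $j=(j_1-1)n_2+j_2$, $k=(k_1-1)n_2+k_2$. (Thus $\mathcal A$ is nonnegative, symmetric, and $\mathcal A_{ljk}\ne0$ only if $l,j,k$ lie in three different blocks.) The objective is $f(x)=-\frac16\mathcal A x^3$ with $\mathcal A x^3:=\sum_{l,j,k}\mathcal A_{ljk}x_lx_jx_k$. *)

theory Defs
  imports "HOL-Analysis.Analysis"
begin

text \<open>
  The index sets are 1-based, and a vector in \<open>\<real>\<^sup>n\<close> is an extensional function on \<open>{1..n}\<close>,
  so that \<open>n\<close> can be the product \<open>n\<^sub>1 n\<^sub>2\<close> of two natural numbers.
\<close>

type_synonym rvec = "nat \<Rightarrow> real"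

abbreviation Rn :: "nat \<Rightarrow> rvec set" where
  "Rn n \<equiv> {1..n} \<rightarrow>\<^sub>E UNIV"

definition flat_index :: "nat \<Rightarrow> nat \<Rightarrow> nat \<Rightarrow> nat" where
  "flat_index n2 i p = (i - 1) * n2 + p"

definition block_of :: "nat \<Rightarrow> nat \<Rightarrow> nat" where
  "block_of n2 l = (l - 1) div n2 + 1"

definition pos_of :: "nat \<Rightarrow> nat \<Rightarrow> nat" where
  "pos_of n2 l = (l - 1) mod n2 + 1"

lemma block_of_flat_index:
  assumes "1 \<le> i" "p \<in> {1..n2}"
  shows "block_of n2 (flat_index n2 i p) = i"
proof -
  from assms(2) obtain q where "p = Suc q" "q < n2" by (cases p) auto
  with assms(1) show ?thesis by (simp add: block_of_def flat_index_def)
qed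

lemma pos_of_flat_index:
  assumes "p \<in> {1..n2}"
  shows "pos_of n2 (flat_index n2 i p) = p"
proof -
  from assms obtain q where "p = Suc q" "q < n2" by (cases p) auto
  then show ?thesis by (simp add: pos_of_def flat_index_def)
qed

definition block :: "nat \<Rightarrow> rvec \<Rightarrow> nat \<Rightarrow> rvec" where
  "block n2 x i = (\<lambda>p. x (flat_index n2 i p))"

definition block_sum :: "nat \<Rightarrow> rvec \<Rightarrow> nat \<Rightarrow> real" where
  "block_sum n2 x i = (\<Sum>p = 1..n2. block n2 x i p)"

definition l0_norm :: "nat \<Rightarrow> rvec \<Rightarrow> nat" where
  "l0_norm n x = card {l \<in> {1..n}. x l \<noteq> 0}"

definition support :: "nat \<Rightarrow> rvec \<Rightarrow> nat set" where
  "support n x = {l \<in> {1..n}. x l > 0}"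

definition largest_pos :: "nat \<Rightarrow> rvec \<Rightarrow> nat \<Rightarrow> nat set" where
  "largest_pos n2 x i = {p. is_arg_max (block n2 x i) (\<lambda>q. q \<in> {1..n2}) p}"

definition first_largest_pos :: "nat \<Rightarrow> rvec \<Rightarrow> nat \<Rightarrow> nat" where
  "first_largest_pos n2 x i = Min (largest_pos n2 x i)"

definition largest_index_set :: "nat \<Rightarrow> nat \<Rightarrow> rvec \<Rightarrow> nat set" where
  "largest_index_set n1 n2 x = (\<Union>i\<in>{1..n1}. {first_largest_pos n2 x i + n2 * (i - 1)})"

definition uniform3_hypergraph :: "nat set \<Rightarrow> nat set set \<Rightarrow> bool" where
  "uniform3_hypergraph V E \<longleftrightarrow> (\<forall>e\<in>E. e \<subseteq> V \<and> card e = 3)"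

type_synonym tensor6 = "nat \<Rightarrow> nat \<Rightarrow> nat \<Rightarrow> nat \<Rightarrow> nat \<Rightarrow> nat \<Rightarrow> real"

text \<open>
  The arguments of a score tensor alternate between the two hypergraphs:
  \<open>B l\<^sub>1 l\<^sub>2 j\<^sub>1 j\<^sub>2 k\<^sub>1 k\<^sub>2\<close> scores matching \<open>l\<^sub>1, j\<^sub>1, k\<^sub>1\<close> with \<open>l\<^sub>2, j\<^sub>2, k\<^sub>2\<close> respectively.
\<close>

definition score_tensor ::
    "nat \<Rightarrow> nat \<Rightarrow> nat set set \<Rightarrow> nat set set \<Rightarrow> tensor6 \<Rightarrow> bool" where
  "score_tensor n1 n2 E1 E2 B \<longleftrightarrow>
     (\<forall>l1\<in>{1..n1}. \<forall>l2\<in>{1..n2}. \<forall>j1\<in>{1..n1}. \<forall>j2\<in>{1..n2}. \<forall>k1\<in>{1..n1}. \<forall>k2\<in>{1..n2}.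
        0 \<le> B l1 l2 j1 j2 k1 k2 \<and>
        (\<not> ({l1, j1, k1} \<in> E1 \<and> {l2, j2, k2} \<in> E2) \<longrightarrow> B l1 l2 j1 j2 k1 k2 = 0)) \<and>
     (\<forall>u \<in> {1..3} \<rightarrow> {1..n1}. \<forall>v \<in> {1..3} \<rightarrow> {1..n2}. \<forall>\<pi>. \<pi> permutes {1..3::nat} \<longrightarrow>
        B (u (\<pi> 1)) (v (\<pi> 1)) (u (\<pi> 2)) (v (\<pi> 2)) (u (\<pi> 3)) (v (\<pi> 3)) =
        B (u 1) (v 1) (u 2) (v 2) (u 3) (v 3))"

definition flat_tensor :: "nat \<Rightarrow> tensor6 \<Rightarrow> nat \<Rightarrow> nat \<Rightarrow> nat \<Rightarrow> real" where
  "flat_tensor n2 B l j k =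
     B (block_of n2 l) (pos_of n2 l) (block_of n2 j) (pos_of n2 j) (block_of n2 k) (pos_of n2 k)"

definition objective :: "nat \<Rightarrow> nat \<Rightarrow> tensor6 \<Rightarrow> rvec \<Rightarrow> real" where
  "objective n1 n2 B x =
     - (1 / 6) * (\<Sum>l = 1..n1 * n2. \<Sum>j = 1..n1 * n2. \<Sum>k = 1..n1 * n2.
                    flat_tensor n2 B l j k * x l * x j * x k)"

definition penalty_objective :: "nat \<Rightarrow> nat \<Rightarrow> tensor6 \<Rightarrow> real \<Rightarrow> rvec \<Rightarrow> real" where
  "penalty_objective n1 n2 B s x =
     objective n1 n2 B x + s / 2 * (\<Sum>i = 1..n1. (block_sum n2 x i - 1)\<^sup>2)"

definition box_feasible :: "nat \<Rightarrow> nat \<Rightarrow> real \<Rightarrow> rvec set" where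
  "box_feasible n1 n2 M = {x \<in> Rn (n1 * n2). \<forall>l\<in>{1..n1 * n2}. 0 \<le> x l \<and> x l \<le> M}"

definition relaxed_feasible :: "nat \<Rightarrow> nat \<Rightarrow> rvec set" where
  "relaxed_feasible n1 n2 =
     {x \<in> Rn (n1 * n2). (\<forall>i\<in>{1..n1}. block_sum n2 x i = 1) \<and> (\<forall>l\<in>{1..n1 * n2}. 0 \<le> x l)}"

definition sparse_feasible :: "nat \<Rightarrow> nat \<Rightarrow> rvec set" where
  "sparse_feasible n1 n2 = {x \<in> relaxed_feasible n1 n2. l0_norm (n1 * n2) x \<le> n1}"

abbreviation global_minimizer :: "(rvec \<Rightarrow> real) \<Rightarrow> rvec set \<Rightarrow> rvec \<Rightarrow> bool" where
  "global_minimizer g S x \<equiv> is_arg_min g (\<lambda>y. y \<in> S) x"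

end

theory Submission
  imports Defs
begin

text \<open>
  A nonzero entry of the tensor involves three different blocks, so \<open>f\<close> is affine in each block
  separately. Hence replacing a block of a minimizer of \<open>(R)\<close> by the unit vector of any position
  in its support gives a minimizer again, and doing so in every block gives a minimizer of \<open>(P)\<close>.
  The largest positions of a block of \<open>z\<close> lie in its support, and by coordinatewise convergence the
  largest positions of \<open>x\<^sup>k\<close> are eventually among those of \<open>z\<close>.
\<close>

section \<open>Conversion between flat indices and pairs of block and position\<close>

lemma block_of_in:
  assumes "l \<in> {1..n1 * n2}"
  shows "block_of n2 l \<in> {1..n1}"
proof -
  have "l - 1 < n1 * n2" using assms by auto
  then have "(l - 1) div n2 < n1" by (rule less_mult_imp_div_less)
  then show ?thesis by (auto simp: block_of_def)
qed

lemma pos_of_in: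
  assumes "l \<in> {1..n1 * n2}"
  shows "pos_of n2 l \<in> {1..n2}"
proof -
  have "0 < n2" using assms by (cases "n2 = 0") auto
  then have "(l - 1) mod n2 < n2" by simp
  then show ?thesis unfolding pos_of_def by auto
qed

lemma flat_index_block_pos:
  assumes "l \<in> {1..n1 * n2}"
  shows "flat_index n2 (block_of n2 l) (pos_of n2 l) = l"
proof -
  have "(l - 1) div n2 * n2 + (l - 1) mod n2 = l - 1" by simp
  then show ?thesis using assms unfolding flat_index_def block_of_def pos_of_def by auto
qed

lemma flat_index_in:
  assumes "i \<in> {1..n1}" "p \<in> {1..n2}"
  shows "flat_index n2 i p \<in> {1..n1 * n2}"
proof -
  have "flat_index n2 i p \<le> (i - 1) * n2 + n2"
    using assms by (simp add: flat_index_def)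
  \<comment> \<open>Subtraction on naturals is truncated; \<open>1 \<le> i\<close> is what makes
    \<open>i - 1\<close> genuine here.\<close>
  also have "\<dots> = i * n2"
    using assms by (cases i) auto
  also have "\<dots> \<le> n1 * n2" using assms by simp
  finally show ?thesis using assms by (auto simp: flat_index_def)
qed

text \<open>One index is chosen per block, and \<open>block_of\<close> recovers the block, so the
  choice is injective. This counts both the support of a selected minimizer and the set of leading
  indices of an iterate.\<close>

lemma card_flat_index_image:
  assumes "\<And>i. i \<in> {1..n1} \<Longrightarrow> p i \<in> {1..n2}"
  shows "card ((\<lambda>i. flat_index n2 i (p i)) ` {1..n1}) = n1"
proof -
  have "inj_on (\<lambda>i. flat_index n2 i (p i)) {1..n1}"
  proof (rule inj_on_inverseI[of _ "block_of n2"])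
    fix i assume "i \<in> {1..n1}"
    then show "block_of n2 (flat_index n2 i (p i)) = i"
      using assms by (intro block_of_flat_index) auto
  qed
  then show ?thesis by (simp add: card_image)
qed

section \<open>The objective is affine in each block\<close>

lemma flat_tensor_nonzero_blocks:
  assumes "uniform3_hypergraph V E1" "score_tensor n1 n2 E1 E2 B"
    and "l \<in> {1..n1 * n2}" "j \<in> {1..n1 * n2}" "k \<in> {1..n1 * n2}"
    and "flat_tensor n2 B l j k \<noteq> 0"
  shows "block_of n2 l \<noteq> block_of n2 j" "block_of n2 l \<noteq> block_of n2 k"
    "block_of n2 j \<noteq> block_of n2 k"
proof -
  \<comment> \<open>A nonzero score forces a hyperedge, and a coincidence of two blocks would leave
    it fewer than three points.\<close>
  have "{block_of n2 l, block_of n2 j, block_of n2 k} \<in> E1"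
    using assms(2,6) block_of_in[OF assms(3)] block_of_in[OF assms(4)] block_of_in[OF assms(5)]
      pos_of_in[OF assms(3)] pos_of_in[OF assms(4)] pos_of_in[OF assms(5)]
    unfolding score_tensor_def flat_tensor_def by blast
  then have "card {block_of n2 l, block_of n2 j, block_of n2 k} = 3"
    using assms(1) by (auto simp: uniform3_hypergraph_def)
  then show "block_of n2 l \<noteq> block_of n2 j" "block_of n2 l \<noteq> block_of n2 k"
    "block_of n2 j \<noteq> block_of n2 k"
    by (auto simp: card_insert_if split: if_splits)
qed

text \<open>A monomial with nonzero coefficient has at most one factor from block \<open>i\<close>,
  and its other factors are common to \<open>u\<close>, \<open>v\<close> and \<open>w\<close>. The
  affine combination is written as an extrapolation from \<open>u\<close> past \<open>w\<close>, the
  form needed to compare a minimizer with both sides.\<close>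

lemma objective_affine_in_block:
  assumes hyp: "uniform3_hypergraph V E1" "score_tensor n1 n2 E1 E2 B"
    and agree: "\<And>l. l \<in> {1..n1 * n2} \<Longrightarrow> block_of n2 l \<noteq> i \<Longrightarrow> u l = w l"
    and comb: "\<And>l. l \<in> {1..n1 * n2} \<Longrightarrow> v l = (1 + s) * w l - s * u l"
  shows "objective n1 n2 B v = (1 + s) * objective n1 n2 B w - s * objective n1 n2 B u"
proof -
  have same: "v l = w l" "u l = w l" if "l \<in> {1..n1 * n2}" "block_of n2 l \<noteq> i" for l
    using agree[OF that] comb[OF that(1)] by (auto simp: algebra_simps)
  have monomial: "flat_tensor n2 B l j k * v l * v j * v k =
      (1 + s) * (flat_tensor n2 B l j k * w l * w j * w k) -
      s * (flat_tensor n2 B l j k * u l * u j * u k)"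
    if l: "l \<in> {1..n1 * n2}" and j: "j \<in> {1..n1 * n2}" and k: "k \<in> {1..n1 * n2}" for l j k
  proof (cases "flat_tensor n2 B l j k = 0")
    case False
    note d = flat_tensor_nonzero_blocks[OF hyp l j k False]
    \<comment> \<open>As the three blocks are distinct, at least two of them differ from
      \<open>i\<close>.\<close>
    consider "block_of n2 j \<noteq> i" "block_of n2 k \<noteq> i" | "block_of n2 l \<noteq> i" "block_of n2 k \<noteq> i"
      | "block_of n2 l \<noteq> i" "block_of n2 j \<noteq> i"
      using d by metis
    then show ?thesis
      by cases (simp_all add: same[OF l] same[OF j] same[OF k] comb[OF l] comb[OF j] comb[OF k]
        algebra_simps)
  qed simp
  have "(\<Sum>l = 1..n1 * n2. \<Sum>j = 1..n1 * n2. \<Sum>k = 1..n1 * n2.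
           flat_tensor n2 B l j k * v l * v j * v k) =
        (\<Sum>l = 1..n1 * n2. \<Sum>j = 1..n1 * n2. \<Sum>k = 1..n1 * n2.
           (1 + s) * (flat_tensor n2 B l j k * w l * w j * w k) -
           s * (flat_tensor n2 B l j k * u l * u j * u k))"
    by (intro sum.cong refl monomial) auto
  also have "\<dots> = (1 + s) * (\<Sum>l = 1..n1 * n2. \<Sum>j = 1..n1 * n2. \<Sum>k = 1..n1 * n2.
           flat_tensor n2 B l j k * w l * w j * w k) -
         s * (\<Sum>l = 1..n1 * n2. \<Sum>j = 1..n1 * n2. \<Sum>k = 1..n1 * n2.
           flat_tensor n2 B l j k * u l * u j * u k)"
    by (simp only: sum_subtractf sum_distrib_left)
  finally show ?thesis unfolding objective_def by (simp only: right_diff_distrib mult.left_commute)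
qed

section \<open>Rounding the blocks of a minimizer to unit vectors\<close>

definition unit_block :: "nat \<Rightarrow> nat \<Rightarrow> nat \<Rightarrow> nat \<Rightarrow> rvec \<Rightarrow> rvec" where
  "unit_block n1 n2 i p w = (\<lambda>l\<in>{1..n1 * n2}.
     if block_of n2 l = i then of_bool (pos_of n2 l = p) else w l)"

lemma block_sum_unit_block:
  assumes "j \<in> {1..n1}" "p \<in> {1..n2}"
  shows "block_sum n2 (unit_block n1 n2 i p w) j = (if j = i then 1 else block_sum n2 w j)"
proof -
  have "block_sum n2 (unit_block n1 n2 i p w) j =
      (\<Sum>q = 1..n2. if j = i then of_bool (q = p) else w (flat_index n2 j q))"
    unfolding block_sum_def block_def
  proof (rule sum.cong)
    fix q assume q: "q \<in> {1..n2}"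
    show "unit_block n1 n2 i p w (flat_index n2 j q) =
        (if j = i then of_bool (q = p) else w (flat_index n2 j q))"
      using q assms flat_index_in[OF assms(1) q] block_of_flat_index[of j q n2]
        pos_of_flat_index[OF q, of j]
      by (auto simp: unit_block_def)
  qed simp
  also have "\<dots> = (if j = i then 1 else block_sum n2 w j)"
    using assms(2) by (auto simp: block_sum_def block_def of_bool_def)
  finally show ?thesis .
qed

text \<open>An affine function on a segment that attains its minimum at an interior point is
  constant there. Positivity of entry \<open>p\<close> leaves room to move from \<open>w\<close>
  away from the unit block without losing feasibility.\<close>

lemma global_minimizer_unit_block:
  assumes hyp: "uniform3_hypergraph V E1" "score_tensor n1 n2 E1 E2 B"
    and min: "global_minimizer (objective n1 n2 B) (relaxed_feasible n1 n2) w"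
    and i: "i \<in> {1..n1}" and p: "p \<in> {1..n2}" and pos: "0 < w (flat_index n2 i p)"
  shows "global_minimizer (objective n1 n2 B) (relaxed_feasible n1 n2) (unit_block n1 n2 i p w)"
proof -
  let ?u = "unit_block n1 n2 i p w"
  define s where "s = w (flat_index n2 i p)"
  \<comment> \<open>\<open>w\<close> lies strictly between \<open>?u\<close> and \<open>v\<close>; the step \<open>s\<close> beyond \<open>w\<close> keeps entry \<open>p\<close> nonnegative
     because \<open>(1 + s) s - s = s\<^sup>2\<close>.\<close>
  define v where "v = (\<lambda>l\<in>{1..n1 * n2}. (1 + s) * w l - s * ?u l)"
  have w: "w \<in> relaxed_feasible n1 n2"
    and le: "\<And>y. y \<in> relaxed_feasible n1 n2 \<Longrightarrow> objective n1 n2 B w \<le> objective n1 n2 B y"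
    using min by (auto simp: is_arg_min_linorder)
  have wnn: "0 \<le> w l" if "l \<in> {1..n1 * n2}" for l
    using w that by (auto simp: relaxed_feasible_def)
  have wsum: "block_sum n2 w j = 1" if "j \<in> {1..n1}" for j
    using w that by (auto simp: relaxed_feasible_def)
  have s: "0 < s" using pos by (simp add: s_def)
  have usum: "block_sum n2 ?u j = 1" if "j \<in> {1..n1}" for j
    using wsum[OF that] by (simp add: block_sum_unit_block[OF that p])
  have u: "?u \<in> relaxed_feasible n1 n2"
    using usum wnn by (auto simp: relaxed_feasible_def unit_block_def)
  have vsum: "block_sum n2 v j = 1" if j: "j \<in> {1..n1}" for j
  proof -
    have "block_sum n2 v j =
        (\<Sum>q = 1..n2. (1 + s) * w (flat_index n2 j q) - s * ?u (flat_index n2 j q))"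
      unfolding block_sum_def block_def
      by (intro sum.cong refl) (use flat_index_in[OF j] in \<open>simp add: v_def\<close>)
    also have "\<dots> = (1 + s) * block_sum n2 w j - s * block_sum n2 ?u j"
      by (simp only: sum_subtractf sum_distrib_left block_sum_def block_def)
    finally show ?thesis using wsum[OF j] usum[OF j] by simp
  qed
  have vnn: "0 \<le> v l" if l: "l \<in> {1..n1 * n2}" for l
  proof -
    consider "block_of n2 l \<noteq> i" | "block_of n2 l = i" "pos_of n2 l = p"
      | "block_of n2 l = i" "pos_of n2 l \<noteq> p" by blast
    then show ?thesis
    proof cases
      case 1
      then have "v l = w l" using l by (simp add: v_def unit_block_def algebra_simps)
      then show ?thesis using wnn[OF l] by simp
    next
      case 2
      then have "w l = s" using flat_index_block_pos[OF l] by (simp add: s_def)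
      then have "v l = s * s" using l 2 by (simp add: v_def unit_block_def algebra_simps)
      then show ?thesis by simp
    next
      case 3
      then have "v l = (1 + s) * w l" using l by (simp add: v_def unit_block_def)
      then show ?thesis using wnn[OF l] s by simp
    qed
  qed
  have "v \<in> relaxed_feasible n1 n2"
    using vsum vnn by (auto simp: relaxed_feasible_def v_def)
  \<comment> \<open>Optimality against \<open>v\<close> on the far side of \<open>w\<close> bounds
    the value at \<open>?u\<close> from above, after cancelling \<open>s > 0\<close>.\<close>
  then have "objective n1 n2 B w \<le> objective n1 n2 B v" by (rule le)
  also have "\<dots> = (1 + s) * objective n1 n2 B w - s * objective n1 n2 B ?u"
    by (rule objective_affine_in_block[OF hyp, where i = i]) (simp_all add: unit_block_def v_def)
  finally have "s * objective n1 n2 B ?u \<le> s * objective n1 n2 B w"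
    by (simp add: algebra_simps)
  then have "objective n1 n2 B ?u \<le> objective n1 n2 B w" using s by simp
  then show ?thesis using u le by (force simp: is_arg_min_linorder)
qed

text \<open>Rounding all blocks in turn preserves optimality for the relaxed problem and leaves
  exactly \<open>n1\<close> nonzero entries.\<close>

lemma global_minimizer_selection:
  assumes hyp: "uniform3_hypergraph V E1" "score_tensor n1 n2 E1 E2 B"
    and min: "global_minimizer (objective n1 n2 B) (relaxed_feasible n1 n2) w"
    and p: "\<And>i. i \<in> {1..n1} \<Longrightarrow> p i \<in> {1..n2}"
    and pos: "\<And>i. i \<in> {1..n1} \<Longrightarrow> 0 < w (flat_index n2 i (p i))"
  shows "\<exists>xs. global_minimizer (objective n1 n2 B) (sparse_feasible n1 n2) xs \<and>
    support (n1 * n2) xs = (\<lambda>i. flat_index n2 i (p i)) ` {1..n1}"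
proof -
  \<comment> \<open>Induction on the number \<open>m\<close> of rounded blocks. Later blocks still
    agree with \<open>w\<close>, so the positivity assumption remains available for block
    \<open>Suc m\<close>.\<close>
  have "\<exists>y. global_minimizer (objective n1 n2 B) (relaxed_feasible n1 n2) y \<and>
     (\<forall>l\<in>{1..n1 * n2}. y l = (if block_of n2 l \<le> m
        then of_bool (pos_of n2 l = p (block_of n2 l)) else w l))" if "m \<le> n1" for m
    using that
  proof (induction m)
    case 0
    then show ?case using min by (auto simp: block_of_def)
  next
    case (Suc m)
    then obtain y where y: "global_minimizer (objective n1 n2 B) (relaxed_feasible n1 n2) y"
      and yl: "\<And>l. l \<in> {1..n1 * n2} \<Longrightarrow> y l = (if block_of n2 l \<le> m
        then of_bool (pos_of n2 l = p (block_of n2 l)) else w l)"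
      by auto
    have m: "Suc m \<in> {1..n1}" using Suc.prems by simp
    have "y (flat_index n2 (Suc m) (p (Suc m))) = w (flat_index n2 (Suc m) (p (Suc m)))"
      using yl[OF flat_index_in[OF m p[OF m]]] block_of_flat_index[OF _ p[OF m], of "Suc m"]
      by simp
    then have "0 < y (flat_index n2 (Suc m) (p (Suc m)))" using pos[OF m] by simp
    from global_minimizer_unit_block[OF hyp y m p[OF m] this]
    have "global_minimizer (objective n1 n2 B) (relaxed_feasible n1 n2)
      (unit_block n1 n2 (Suc m) (p (Suc m)) y)" .
    moreover have "unit_block n1 n2 (Suc m) (p (Suc m)) y l = (if block_of n2 l \<le> Suc m
        then of_bool (pos_of n2 l = p (block_of n2 l)) else w l)" if "l \<in> {1..n1 * n2}" for l
      using that yl[OF that] by (auto simp: unit_block_def)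
    ultimately show ?case by blast
  qed
  then obtain y where y: "global_minimizer (objective n1 n2 B) (relaxed_feasible n1 n2) y"
    and yl: "\<And>l. l \<in> {1..n1 * n2} \<Longrightarrow> y l = (if block_of n2 l \<le> n1
        then of_bool (pos_of n2 l = p (block_of n2 l)) else w l)"
    by blast
  have yb: "y l = of_bool (pos_of n2 l = p (block_of n2 l))" if "l \<in> {1..n1 * n2}" for l
    using yl[OF that] block_of_in[OF that] by simp
  have set: "{l \<in> {1..n1 * n2}. pos_of n2 l = p (block_of n2 l)} =
      (\<lambda>i. flat_index n2 i (p i)) ` {1..n1}"
  proof (intro equalityI subsetI)
    fix l assume l: "l \<in> {l \<in> {1..n1 * n2}. pos_of n2 l = p (block_of n2 l)}"
    then have "l = flat_index n2 (block_of n2 l) (p (block_of n2 l))"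
      using flat_index_block_pos[of l n1 n2] by auto
    then show "l \<in> (\<lambda>i. flat_index n2 i (p i)) ` {1..n1}"
      using l block_of_in[of l n1 n2] by blast
  next
    fix l assume "l \<in> (\<lambda>i. flat_index n2 i (p i)) ` {1..n1}"
    then obtain i where i: "i \<in> {1..n1}" "l = flat_index n2 i (p i)" by blast
    then show "l \<in> {l \<in> {1..n1 * n2}. pos_of n2 l = p (block_of n2 l)}"
      using flat_index_in[OF i(1) p[OF i(1)]] block_of_flat_index[OF _ p[OF i(1)], of i]
        pos_of_flat_index[OF p[OF i(1)], of i]
      by simp
  qed
  have supp: "support (n1 * n2) y = (\<lambda>i. flat_index n2 i (p i)) ` {1..n1}"
    unfolding set[symmetric] support_def using yb by auto
  have "{l \<in> {1..n1 * n2}. y l \<noteq> 0} = (\<lambda>i. flat_index n2 i (p i)) ` {1..n1}"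
    unfolding set[symmetric] using yb by auto
  then have "l0_norm (n1 * n2) y = n1"
    unfolding l0_norm_def by (simp only: card_flat_index_image[OF p])
  then have "y \<in> sparse_feasible n1 n2"
    using y by (auto simp: sparse_feasible_def is_arg_min_linorder)
  \<comment> \<open>A minimizer over the larger relaxed set that lies in the sparse set is a
    minimizer there too.\<close>
  then have "global_minimizer (objective n1 n2 B) (sparse_feasible n1 n2) y"
    using y by (auto simp: sparse_feasible_def is_arg_min_linorder)
  then show ?thesis using supp by blast
qed

section \<open>Largest positions and their behaviour under limits\<close>

lemma largest_pos_iff:
  "p \<in> largest_pos n2 y i \<longleftrightarrow>
    p \<in> {1..n2} \<and> (\<forall>q\<in>{1..n2}. y (flat_index n2 i q) \<le> y (flat_index n2 i p))"
  by (auto simp: largest_pos_def is_arg_max_linorder block_def)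

lemma first_largest_pos_in:
  assumes "0 < n2"
  shows "first_largest_pos n2 y i \<in> largest_pos n2 y i"
proof -
  have fin: "finite (largest_pos n2 y i)"
    by (rule finite_subset[of _ "{1..n2}"]) (auto simp: largest_pos_iff)
  define m where "m = Max ((\<lambda>q. y (flat_index n2 i q)) ` {1..n2})"
  have "m \<in> (\<lambda>q. y (flat_index n2 i q)) ` {1..n2}"
    unfolding m_def using assms by (intro Max_in) auto
  then obtain p where p: "p \<in> {1..n2}" "y (flat_index n2 i p) = m" by blast
  have "y (flat_index n2 i q) \<le> m" if "q \<in> {1..n2}" for q
    unfolding m_def using that by (intro Max_ge) auto
  then have "p \<in> largest_pos n2 y i" using p by (auto simp: largest_pos_iff)
  then show ?thesis unfolding first_largest_pos_def using fin by (intro Min_in) auto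
qed

text \<open>Otherwise no entry of the block would be positive, and the block could not sum to
  1.\<close>

lemma largest_pos_positive:
  assumes "w \<in> relaxed_feasible n1 n2" "i \<in> {1..n1}" "p \<in> largest_pos n2 w i"
  shows "0 < w (flat_index n2 i p)"
proof (rule ccontr)
  assume "\<not> 0 < w (flat_index n2 i p)"
  then have "w (flat_index n2 i q) \<le> 0" if "q \<in> {1..n2}" for q
    using assms(3) that unfolding largest_pos_iff by (meson leI order_trans)
  then have "block_sum n2 w i \<le> 0"
    unfolding block_sum_def block_def by (intro sum_nonpos) auto
  then show False using assms by (auto simp: relaxed_feasible_def)
qed

lemma largest_index_set_eq:
  "largest_index_set n1 n2 y = (\<lambda>i. flat_index n2 i (first_largest_pos n2 y i)) ` {1..n1}"
  by (auto simp: largest_index_set_def flat_index_def mult.commute add.commute)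

text \<open>Finitely many strict inequalities between entries of \<open>w\<close> persist near the
  limit. Ties in \<open>w\<close> may be broken differently for each \<open>k\<close>, so only
  membership can be claimed.\<close>

lemma eventually_first_largest_pos:
  assumes lim: "limitin (powertop_real {1..n1 * n2}) x w F" and n2: "0 < n2"
  shows "\<forall>\<^sub>F k in F. \<forall>i\<in>{1..n1}. first_largest_pos n2 (x k) i \<in> largest_pos n2 w i"
proof -
  have conv: "((\<lambda>k. x k l) \<longlongrightarrow> w l) F" if "l \<in> {1..n1 * n2}" for l
    using lim that by (auto simp: limitin_componentwise)
  \<comment> \<open>The contrapositive is used because being beaten strictly by some
    \<open>r\<close> is an open condition, whereas being largest is not.\<close>
  have ev: "\<forall>\<^sub>F k in F. q \<notin> largest_pos n2 w i \<longrightarrow> q \<notin> largest_pos n2 (x k) i"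
    if i: "i \<in> {1..n1}" and q: "q \<in> {1..n2}" for i q
  proof (cases "q \<in> largest_pos n2 w i")
    case False
    then obtain r where r: "r \<in> {1..n2}" "w (flat_index n2 i q) < w (flat_index n2 i r)"
      using q by (force simp: largest_pos_iff)
    have "((\<lambda>k. x k (flat_index n2 i r) - x k (flat_index n2 i q)) \<longlongrightarrow>
        w (flat_index n2 i r) - w (flat_index n2 i q)) F"
      using conv flat_index_in i q r(1) by (intro tendsto_diff) blast+
    then have "\<forall>\<^sub>F k in F. 0 < x k (flat_index n2 i r) - x k (flat_index n2 i q)"
      by (rule order_tendstoD) (use r(2) in simp)
    then show ?thesis
      by (rule eventually_mono) (use r in \<open>force simp: largest_pos_iff\<close>)
  qed simp
  have "\<forall>\<^sub>F k in F. \<forall>i\<in>{1..n1}. \<forall>q\<in>{1..n2}.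
      q \<notin> largest_pos n2 w i \<longrightarrow> q \<notin> largest_pos n2 (x k) i"
    by (intro eventually_ball_finite ballI ev finite_atLeastAtMost)
  then show ?thesis
  proof (rule eventually_mono)
    fix k assume *: "\<forall>i\<in>{1..n1}. \<forall>q\<in>{1..n2}.
      q \<notin> largest_pos n2 w i \<longrightarrow> q \<notin> largest_pos n2 (x k) i"
    show "\<forall>i\<in>{1..n1}. first_largest_pos n2 (x k) i \<in> largest_pos n2 w i"
      using * first_largest_pos_in[OF n2, of "x k"] by (meson largest_pos_iff)
  qed
qed

section \<open>The three cases, with one threshold for all of them\<close>

theorem theorem4:
  fixes n1 n2 :: nat
    and E1 E2 :: "nat set set"
    and B :: tensor6
    and \<sigma> :: "nat \<Rightarrow> real"
    and M :: real
    and x :: "nat \<Rightarrow> rvec"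
    and K :: "nat set"
    and z :: rvec
  assumes "1 \<le> n1" and "n1 \<le> n2"
    and "uniform3_hypergraph {1..n1} E1" and "uniform3_hypergraph {1..n2} E2"
    and "score_tensor n1 n2 E1 E2 B"
    and "mono_on {1..} \<sigma>" and "\<forall>k\<ge>1. 0 < \<sigma> k" and "filterlim \<sigma> at_top sequentially"
    and "1 \<le> M"
    and "\<forall>k\<ge>1. global_minimizer (penalty_objective n1 n2 B (\<sigma> k)) (box_feasible n1 n2 M) (x k)"
    and "K \<subseteq> {1..}" and "infinite K"
    and "limitin (powertop_real {1..n1 * n2}) x z (inf sequentially (principal K))"
    and "global_minimizer (objective n1 n2 B) (relaxed_feasible n1 n2) z"
  shows
    "(l0_norm (n1 * n2) z = n1 \<longrightarrow>
        (\<exists>k0>0. \<forall>k\<in>K. k \<ge> k0 \<longrightarrow> support (n1 * n2) z = largest_index_set n1 n2 (x k)))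
     \<and> (l0_norm (n1 * n2) z > n1 \<and> (\<forall>i\<in>{1..n1}. card (largest_pos n2 z i) = 1) \<longrightarrow>
        (\<exists>xs. global_minimizer (objective n1 n2 B) (sparse_feasible n1 n2) xs \<and>
          (\<exists>k0>0. \<forall>k\<in>K. k \<ge> k0 \<longrightarrow> support (n1 * n2) xs = largest_index_set n1 n2 (x k))))
     \<and> (l0_norm (n1 * n2) z > n1 \<and> (\<exists>i\<in>{1..n1}. card (largest_pos n2 z i) > 1) \<longrightarrow>
        (\<exists>xs K'. global_minimizer (objective n1 n2 B) (sparse_feasible n1 n2) xs \<and>
          K' \<subseteq> K \<and> infinite K' \<and>
          (\<exists>k0>0. \<forall>k\<in>K'. k \<ge> k0 \<longrightarrow> support (n1 * n2) xs = largest_index_set n1 n2 (x k))))"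
proof -
  have n2: "0 < n2" using assms(1,2) by simp
  have z: "z \<in> relaxed_feasible n1 n2" using assms(14) by (simp add: is_arg_min_linorder)
  from eventually_first_largest_pos[OF assms(13) n2]
  obtain N where N: "\<And>k i. k \<in> K \<Longrightarrow> k \<ge> N \<Longrightarrow> i \<in> {1..n1} \<Longrightarrow>
      first_largest_pos n2 (x k) i \<in> largest_pos n2 z i"
    unfolding eventually_inf_principal eventually_sequentially by blast
  \<comment> \<open>The successor guarantees a positive threshold.\<close>
  define k0 where "k0 = Suc N"
  have flp: "first_largest_pos n2 (x k) i \<in> largest_pos n2 z i"
    if "k \<in> K" "k \<ge> k0" "i \<in> {1..n1}" for k i
    using N[of k i] that by (simp add: k0_def)
  have k0: "0 < k0" by (simp add: k0_def)
  have range: "first_largest_pos n2 (x k) i \<in> {1..n2}" for k i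
    using first_largest_pos_in[OF n2] largest_pos_iff by blast
  have pos: "0 < z (flat_index n2 i (first_largest_pos n2 (x k) i))"
    if "k \<in> K" "k \<ge> k0" "i \<in> {1..n1}" for k i
    using largest_pos_positive[OF z that(3) flp[OF that]] .
  \<comment> \<open>Each late iterate selects positive entries of \<open>z\<close>, so rounding
    \<open>z\<close> at these positions solves the sparse problem.\<close>
  have sel: "\<exists>xs. global_minimizer (objective n1 n2 B) (sparse_feasible n1 n2) xs \<and>
      support (n1 * n2) xs = largest_index_set n1 n2 (x k)" if "k \<in> K" "k \<ge> k0" for k
    unfolding largest_index_set_eq
    using pos[OF that] range by (intro global_minimizer_selection[OF assms(3,5,14)])
  have inf: "infinite (K \<inter> {k0..})"
  proof
    assume "finite (K \<inter> {k0..})"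
    then have "finite (K \<inter> {k0..} \<union> {..<k0})" by simp
    then have "finite K" by (rule rev_finite_subset) auto
    then show False using assms(12) by simp
  qed
  have part1: "support (n1 * n2) z = largest_index_set n1 n2 (x k)"
    if l0: "l0_norm (n1 * n2) z = n1" and k: "k \<in> K" "k \<ge> k0" for k
  proof -
    \<comment> \<open>Nonnegativity of \<open>z\<close> identifies its nonzero entries with its
      support; the leading indices form a subset of it with the same size \<open>n1\<close>.\<close>
    have "{l \<in> {1..n1 * n2}. z l \<noteq> 0} = support (n1 * n2) z"
      using z by (force simp: support_def relaxed_feasible_def)
    then have "card (support (n1 * n2) z) = n1" using l0 by (simp add: l0_norm_def)
    moreover have "card (largest_index_set n1 n2 (x k)) = n1"
      unfolding largest_index_set_eq using range by (rule card_flat_index_image)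
    moreover have "largest_index_set n1 n2 (x k) \<subseteq> support (n1 * n2) z"
      unfolding largest_index_set_eq support_def
      using pos[OF k] flat_index_in[OF _ range] by blast
    moreover have "finite (support (n1 * n2) z)" by (simp add: support_def)
    ultimately show ?thesis by (metis card_subset_eq)
  qed
  have part2: "\<exists>xs. global_minimizer (objective n1 n2 B) (sparse_feasible n1 n2) xs \<and>
      (\<forall>k\<in>K. k \<ge> k0 \<longrightarrow> support (n1 * n2) xs = largest_index_set n1 n2 (x k))"
    if single: "\<forall>i\<in>{1..n1}. card (largest_pos n2 z i) = 1"
  proof -
    obtain k1 where k1: "k1 \<in> K" "k1 \<ge> k0"
      using infinite_imp_nonempty[OF inf] by blast
    obtain xs where xs: "global_minimizer (objective n1 n2 B) (sparse_feasible n1 n2) xs"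
      "support (n1 * n2) xs = largest_index_set n1 n2 (x k1)"
      using sel[OF k1] by blast
    \<comment> \<open>With a unique largest position in every block of \<open>z\<close>, all late
      iterates make the same selection, so the minimizer built from \<open>k1\<close> serves them
      all.\<close>
    have "largest_index_set n1 n2 (x k1) = largest_index_set n1 n2 (x k)"
      if k: "k \<in> K" "k \<ge> k0" for k
      unfolding largest_index_set_eq
    proof (rule image_cong[OF refl])
      fix i assume i: "i \<in> {1..n1}"
      then have "first_largest_pos n2 (x k1) i = first_largest_pos n2 (x k) i"
        using single flp[OF k1 i] flp[OF k i] by (metis card_1_singletonE singletonD)
      then show "flat_index n2 i (first_largest_pos n2 (x k1) i) =
          flat_index n2 i (first_largest_pos n2 (x k) i)" by simp
    qed
    then show ?thesis using xs by auto
  qed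
  have part3: "\<exists>xs K'. global_minimizer (objective n1 n2 B) (sparse_feasible n1 n2) xs \<and>
      K' \<subseteq> K \<and> infinite K' \<and>
      (\<forall>k\<in>K'. k \<ge> k0 \<longrightarrow> support (n1 * n2) xs = largest_index_set n1 n2 (x k))"
  proof -
    \<comment> \<open>The selection may now vary with \<open>k\<close>, but it takes finitely many
      values; one of them recurs infinitely often and yields the subsequence.\<close>
    have "(\<lambda>k. largest_index_set n1 n2 (x k)) ` (K \<inter> {k0..}) \<subseteq> Pow {1..n1 * n2}"
      unfolding largest_index_set_eq using flat_index_in[OF _ range] by blast
    then have "finite ((\<lambda>k. largest_index_set n1 n2 (x k)) ` (K \<inter> {k0..}))"
      by (rule finite_subset) simp
    from pigeonhole_infinite[OF inf this] obtain k1 where k1: "k1 \<in> K" "k1 \<ge> k0"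
      and inf': "infinite {k \<in> K \<inter> {k0..}.
        largest_index_set n1 n2 (x k) = largest_index_set n1 n2 (x k1)}"
      by auto
    obtain xs where xs: "global_minimizer (objective n1 n2 B) (sparse_feasible n1 n2) xs"
      "support (n1 * n2) xs = largest_index_set n1 n2 (x k1)"
      using sel[OF k1] by blast
    show ?thesis
      by (intro exI[of _ xs] exI[of _ "{k \<in> K \<inter> {k0..}.
        largest_index_set n1 n2 (x k) = largest_index_set n1 n2 (x k1)}"] conjI)
        (use xs inf' in auto)
  qed
  show ?thesis
    using part1 part2 part3 k0 by blast
qed

end
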